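(* Let $p>1$ be a squarefree integer and let $x+y\sqrt p$ (with $x,y\in\mathbb{Q}$) be an indecomposable element of $\mathcal{O}_{\mathbb{Q}(\sqrt p)}^+$. Then $x+y\sqrt p$ can decompose only in biquadratic fields $\mathbb{Q}(\sqrt p,\sqrt q)$ with $\min\{q,r\}<16x^2$. That is: if $q$ is a squarefree positive integer such that $K=\mathbb{Q}(\sqrt p,\sqrt q)$ is a biquadratic number field, $r=\frac{pq}{\gcd(p,q)^2}$, and $x+y\sqrt p=\alpha+\alpha'$ for some $\alpha,\alpha'\in\mathcal{O}_K^+$, then $\min\{q,r\}<16x^2$.
   Context: For a totally real number field $F$, $\mathcal{O}_F$ is its ring of integers and $\mathcal{O}_F^+$ is the set of totally positive integers, i.e. elements $\alpha\in\mathcal{O}_F$ with $\sigma(\alpha)>0$ for every embedding $\sigma:F\to\mathbb{C}$. An element $\alpha\in\mathcal{O}_F^+$ is indecomposable (in $F$) if it cannot be written as $\alpha=\beta+\gamma$ with $\beta,\gamma\in\mathcal{O}_F^+$; otherwise it decomposes in $F$. A biquadratic field $\mathbb{Q}(\sqrt p,\sqrt q)$ has degree 4 over $\mathbb{Q}$. *)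

theory Defs
  imports Complex_Main "HOL-Computational_Algebra.Computational_Algebra"
begin

text \<open>Number fields are represented as subsets of an ambient field of characteristic 0
  (below: of the real numbers).\<close>

definition is_subfield :: "'a::field_char_0 set \<Rightarrow> bool" where
  "is_subfield K \<longleftrightarrow>
     1 \<in> K \<and> (\<forall>a\<in>K. \<forall>b\<in>K. a - b \<in> K \<and> a * b \<in> K) \<and> (\<forall>a\<in>K. inverse a \<in> K)"

text \<open>In characteristic 0 every subfield contains the rationals, so the subfield generated
  by \<open>S\<close> is \<open>\<rat>(S)\<close>.\<close>

definition rat_adjoin :: "'a::field_char_0 set \<Rightarrow> 'a set" where
  "rat_adjoin S = is_subfield hull S"

global_interpretation rat_vs: vector_space "\<lambda>(c::rat) (v::'a::field_char_0). of_rat c * v"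
  by unfold_locales (simp_all add: algebra_simps of_rat_add of_rat_mult)

text \<open>\<open>dim\<close> is 0 for infinite-dimensional spaces, so only positive values are meaningful.\<close>

definition degree_over_rat :: "'a::field_char_0 set \<Rightarrow> nat" where
  "degree_over_rat K = rat_vs.dim K"

definition ring_of_integers :: "'a::field_char_0 set \<Rightarrow> 'a set" where
  "ring_of_integers K = {a \<in> K. algebraic_int a}"

text \<open>Only the values of an embedding on \<open>K\<close> matter. Injectivity is automatic, since a
  unital ring homomorphism from a field is injective.\<close>

definition embeddings :: "'a::field_char_0 set \<Rightarrow> ('a \<Rightarrow> complex) set" where
  "embeddings K = {\<sigma>. \<sigma> 1 = 1 \<and>
     (\<forall>a\<in>K. \<forall>b\<in>K. \<sigma> (a + b) = \<sigma> a + \<sigma> b \<and> \<sigma> (a * b) = \<sigma> a * \<sigma> b)}"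

definition totally_positive_integers :: "'a::field_char_0 set \<Rightarrow> 'a set" where
  "totally_positive_integers K =
     {a \<in> ring_of_integers K. \<forall>\<sigma>\<in>embeddings K. \<sigma> a \<in> \<real> \<and> Re (\<sigma> a) > 0}"

definition indecomposable :: "'a::field_char_0 set \<Rightarrow> 'a \<Rightarrow> bool" where
  "indecomposable K a \<longleftrightarrow> a \<in> totally_positive_integers K \<and>
     \<not> (\<exists>b\<in>totally_positive_integers K. \<exists>c\<in>totally_positive_integers K. a = b + c)"

end

theory Submission
  imports Defs "Jordan_Normal_Form.Char_Poly"
begin

text \<open>Write \<open>\<alpha> = a + b\<surd>p + c\<surd>q + d\<surd>p\<surd>q\<close>. Positivity of the four conjugates of \<open>\<alpha>\<close>, added in pairs,
  gives \<open>\<bar>c\<bar>\<surd>q < a\<close> and \<open>\<bar>d\<bar>\<surd>(pq) < a\<close>; the same applies to \<open>\<alpha>'\<close>, whose coefficients are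
  \<open>x - a\<close>, \<open>y - b\<close>, \<open>-c\<close>, \<open>-d\<close>. Hence \<open>2\<bar>c\<bar>\<surd>q < x\<close> and \<open>2\<bar>d\<bar>\<surd>(pq) < x\<close>. Alternating sums of the
  conjugates show that \<open>4c\<surd>q\<close> and \<open>4d\<surd>(pq) = 4dg\<surd>r\<close>, where \<open>g = gcd p q\<close>, are algebraic
  integers, so \<open>4c\<close> and \<open>4dg\<close> are integers since \<open>q\<close> and \<open>r\<close> are squarefree. They cannot both
  vanish, since then the decomposition would take place in \<open>\<rat>(\<surd>p)\<close>.\<close>

section \<open>Quadratic extensions of subfields and their embeddings into the complex
  numbers\<close>

definition quadratic_extension :: "'a::field_char_0 set \<Rightarrow> 'a \<Rightarrow> 'a set" where
  "quadratic_extension F s = {a + b * s |a b. a \<in> F \<and> b \<in> F}"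

context
  fixes F :: "'a::field_char_0 set"
  assumes F: "is_subfield F"
begin

lemma subfield_1: "1 \<in> F"
  and subfield_diff: "a \<in> F \<Longrightarrow> b \<in> F \<Longrightarrow> a - b \<in> F"
  and subfield_mult: "a \<in> F \<Longrightarrow> b \<in> F \<Longrightarrow> a * b \<in> F"
  and subfield_inverse: "a \<in> F \<Longrightarrow> inverse a \<in> F"
  using F by (auto simp: is_subfield_def)

lemma subfield_0: "0 \<in> F"
  using subfield_diff[OF subfield_1 subfield_1] by simp

lemma subfield_uminus: "a \<in> F \<Longrightarrow> - a \<in> F"
  using subfield_diff[OF subfield_0] by simp

lemma subfield_add: "a \<in> F \<Longrightarrow> b \<in> F \<Longrightarrow> a + b \<in> F"
  using subfield_diff[OF _ subfield_uminus, of a b] by simp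

lemma subfield_divide: "a \<in> F \<Longrightarrow> b \<in> F \<Longrightarrow> a / b \<in> F"
  by (simp add: divide_inverse subfield_mult subfield_inverse)

lemma subfield_of_int: "of_int n \<in> F"
proof -
  have "of_nat k \<in> F" for k
    by (induction k) (auto intro: subfield_0 subfield_1 subfield_add)
  then show ?thesis
    by (cases n) (simp_all del: of_nat_Suc add: subfield_uminus)
qed

lemma subfield_of_rat: "of_rat x \<in> F"
  by (cases x) (simp add: of_rat_rat subfield_divide subfield_of_int)

lemma quadratic_extension_base: "a \<in> F \<Longrightarrow> a \<in> quadratic_extension F s"
  unfolding quadratic_extension_def using subfield_0 by force

lemma quadratic_extension_generator: "s \<in> quadratic_extension F s"
  unfolding quadratic_extension_def using subfield_0 subfield_1 by force

lemma quadratic_extension_eq_base: "s \<in> F \<Longrightarrow> quadratic_extension F s = F"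
  using quadratic_extension_base
  by (auto simp: quadratic_extension_def intro!: subfield_add subfield_mult)

text \<open>A nonzero \<open>a + b * s\<close> is inverted by means of its conjugate
  \<open>a - b * s\<close>. If \<open>s \<in> F\<close>, the conjugate of a nonzero element can
  vanish, so that case is split off; the extension is then \<open>F\<close> itself.\<close>

lemma is_subfield_quadratic_extension:
  assumes s2: "s * s \<in> F"
  shows "is_subfield (quadratic_extension F s)"
proof (cases "s \<in> F")
  case True
  then show ?thesis using F by (simp add: quadratic_extension_eq_base)
next
  case False
  let ?E = "quadratic_extension F s"
  have EI: "a + b * s \<in> ?E" if "a \<in> F" "b \<in> F" for a b
    using that by (auto simp: quadratic_extension_def)
  have diff: "u - v \<in> ?E" if uv: "u \<in> ?E" "v \<in> ?E" for u v
  proof -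
    obtain a b c d where *: "a \<in> F" "b \<in> F" "c \<in> F" "d \<in> F" "u = a + b * s" "v = c + d * s"
      using uv by (auto simp: quadratic_extension_def)
    have "u - v = (a - c) + (b - d) * s" by (simp add: * algebra_simps)
    then show ?thesis using EI * subfield_diff by metis
  qed
  have mult: "u * v \<in> ?E" if uv: "u \<in> ?E" "v \<in> ?E" for u v
  proof -
    obtain a b c d where *: "a \<in> F" "b \<in> F" "c \<in> F" "d \<in> F" "u = a + b * s" "v = c + d * s"
      using uv by (auto simp: quadratic_extension_def)
    have "u * v = (a * c + b * d * (s * s)) + (a * d + b * c) * s" by (simp add: * algebra_simps)
    then show ?thesis using EI * s2 subfield_add subfield_mult by metis
  qed
  have inv: "inverse u \<in> ?E" if u: "u \<in> ?E" for u
  proof (cases "u = 0")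
    case True
    then show ?thesis using u by simp
  next
    case u0: False
    obtain a b where *: "a \<in> F" "b \<in> F" "u = a + b * s"
      using u by (auto simp: quadratic_extension_def)
    \<comment> \<open>\<open>N\<close> is the norm of \<open>u\<close>, the product of
      \<open>u\<close> with its conjugate.\<close>
    define N where "N = a * a - b * b * (s * s)"
    have N: "N \<in> F" unfolding N_def using subfield_diff subfield_mult *(1,2) s2 by metis
    have "a - b * s \<noteq> 0"
    proof
      assume ab: "a - b * s = 0"
      show False
      proof (cases "b = 0")
        case True
        then show False using ab u0 * by simp
      next
        case False
        then have "s = a / b" using ab by (simp add: field_simps)
        then show False using \<open>s \<notin> F\<close> * subfield_divide by simp
      qed
    qed
    moreover have "N = u * (a - b * s)" by (simp add: N_def * algebra_simps)
    ultimately have "inverse u = (a - b * s) / N"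
      by (simp add: inverse_eq_divide)
    then have "inverse u = a / N + (- b / N) * s"
      by (simp add: diff_divide_distrib)
    then show ?thesis
      using EI * N subfield_divide subfield_uminus by metis
  qed
  show ?thesis
    unfolding is_subfield_def
    using diff mult inv quadratic_extension_base[OF subfield_1] by blast
qed

text \<open>Coordinates with respect to \<open>1, s\<close> are unique because
  \<open>s \<notin> F\<close>, so the formula is well defined; it respects products because
  \<open>t\<close> squares to the image of \<open>s * s\<close>. The freedom to take either square
  root is what later produces the conjugates.\<close>

lemma extend_embedding:
  assumes s: "s \<notin> F" "s * s \<in> F" and \<tau>: "\<tau> \<in> embeddings F" and t: "t * t = \<tau> (s * s)"
  obtains \<sigma> where "\<sigma> \<in> embeddings (quadratic_extension F s)"
    and "\<And>a b. a \<in> F \<Longrightarrow> b \<in> F \<Longrightarrow> \<sigma> (a + b * s) = \<tau> a + \<tau> b * t"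
proof -
  have unique: "a = c \<and> b = d"
    if *: "a \<in> F" "b \<in> F" "c \<in> F" "d \<in> F" "a + b * s = c + d * s" for a b c d
  proof (rule ccontr)
    assume contra: "\<not> (a = c \<and> b = d)"
    have eq: "(b - d) * s = c - a" using *(5) by (simp add: algebra_simps)
    then have "b \<noteq> d" using contra by auto
    then have "s = (c - a) / (b - d)" using eq by (simp add: field_simps)
    then show False using s(1) * subfield_divide subfield_diff by simp
  qed
  \<comment> \<open>The choice reads off the coordinates of \<open>v\<close>. Outside the extension
    the value is arbitrary, which \<open>embeddings\<close> permits.\<close>
  define \<sigma> where "\<sigma> v = (let w = (SOME w. fst w \<in> F \<and> snd w \<in> F \<and> v = fst w + snd w * s)
    in \<tau> (fst w) + \<tau> (snd w) * t)" for v
  have \<sigma>: "\<sigma> (a + b * s) = \<tau> a + \<tau> b * t" if ab: "a \<in> F" "b \<in> F" for a b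
  proof -
    have "(SOME w. fst w \<in> F \<and> snd w \<in> F \<and> a + b * s = fst w + snd w * s) = (a, b)"
      (is "(SOME w. ?R w) = _")
    proof (rule some_equality)
      show "?R (a, b)" using ab by simp
      show "w = (a, b)" if "?R w" for w
        using unique[OF ab, of "fst w" "snd w"] that by (simp add: prod_eq_iff)
    qed
    then show ?thesis by (simp add: \<sigma>_def)
  qed
  have \<tau>1: "\<tau> 1 = 1" and \<tau>_add: "\<And>a b. a \<in> F \<Longrightarrow> b \<in> F \<Longrightarrow> \<tau> (a + b) = \<tau> a + \<tau> b"
    and \<tau>_mult: "\<And>a b. a \<in> F \<Longrightarrow> b \<in> F \<Longrightarrow> \<tau> (a * b) = \<tau> a * \<tau> b"
    using \<tau> by (auto simp: embeddings_def)
  have \<tau>0: "\<tau> 0 = 0" using \<tau>_add[OF subfield_0 subfield_0] by simp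
  have "\<sigma> 1 = 1" using \<sigma>[OF subfield_1 subfield_0] by (simp add: \<tau>0 \<tau>1)
  moreover have "\<sigma> (u + v) = \<sigma> u + \<sigma> v \<and> \<sigma> (u * v) = \<sigma> u * \<sigma> v"
    if uv: "u \<in> quadratic_extension F s" "v \<in> quadratic_extension F s" for u v
  proof -
    obtain a b c d where *: "a \<in> F" "b \<in> F" "c \<in> F" "d \<in> F" "u = a + b * s" "v = c + d * s"
      using uv by (auto simp: quadratic_extension_def)
    have "u + v = (a + c) + (b + d) * s" by (simp add: * algebra_simps)
    then have "\<sigma> (u + v) = \<tau> (a + c) + \<tau> (b + d) * t"
      by (simp only: \<sigma> * subfield_add)
    then have 1: "\<sigma> (u + v) = \<sigma> u + \<sigma> v" by (simp add: * \<sigma> \<tau>_add algebra_simps)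
    have "u * v = (a * c + b * d * (s * s)) + (a * d + b * c) * s" by (simp add: * algebra_simps)
    then have "\<sigma> (u * v) = \<tau> (a * c + b * d * (s * s)) + \<tau> (a * d + b * c) * t"
      by (simp only: \<sigma> * s(2) subfield_add subfield_mult)
    also have "\<dots> = \<tau> a * \<tau> c + \<tau> b * \<tau> d * (t * t) + (\<tau> a * \<tau> d + \<tau> b * \<tau> c) * t"
      using * s(2) by (simp add: \<tau>_add \<tau>_mult subfield_add subfield_mult t)
    also have "\<dots> = \<sigma> u * \<sigma> v" by (simp add: * \<sigma> algebra_simps)
    finally show ?thesis using 1 by blast
  qed
  ultimately have "\<sigma> \<in> embeddings (quadratic_extension F s)" by (auto simp: embeddings_def)
  then show thesis using that \<sigma> by blast
qed

text \<open>Every embedding of \<open>F\<close> is the restriction of an embedding of the extension,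
  so positivity descends. This carries a decomposition whose summands lie in \<open>F\<close> down
  to \<open>F\<close>.\<close>

lemma totally_positive_integers_base:
  assumes s: "s \<notin> F" "s * s \<in> F" and a: "a \<in> F"
    and tp: "a \<in> totally_positive_integers (quadratic_extension F s)"
  shows "a \<in> totally_positive_integers F"
proof -
  have "\<tau> a \<in> \<real> \<and> Re (\<tau> a) > 0" if \<tau>: "\<tau> \<in> embeddings F" for \<tau>
  proof -
    \<comment> \<open>A complex square root of \<open>\<tau> (s * s)\<close> always exists, so every
      \<open>\<tau>\<close> extends.\<close>
    obtain \<sigma> where \<sigma>: "\<sigma> \<in> embeddings (quadratic_extension F s)"
      "\<And>a b. a \<in> F \<Longrightarrow> b \<in> F \<Longrightarrow> \<sigma> (a + b * s) = \<tau> a + \<tau> b * csqrt (\<tau> (s * s))"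
      using extend_embedding[OF s \<tau>, of "csqrt (\<tau> (s * s))"]
      by (metis power2_csqrt power2_eq_square)
    have "\<tau> (0 + 0) = \<tau> 0 + \<tau> 0" using \<tau> subfield_0 unfolding embeddings_def by blast
    then have "\<sigma> a = \<tau> a" using \<sigma>(2)[OF a subfield_0] by simp
    then show ?thesis using tp \<sigma>(1) by (auto simp: totally_positive_integers_def)
  qed
  then show ?thesis using tp a by (auto simp: totally_positive_integers_def ring_of_integers_def)
qed

text \<open>An embedding fixes the integers, hence commutes with evaluation of integer polynomials
  and preserves the roots of a monic one.\<close>

lemma algebraic_int_embedding:
  assumes \<sigma>: "\<sigma> \<in> embeddings F" and a: "a \<in> F" "algebraic_int a"
  shows "algebraic_int (\<sigma> a)"
proof -
  have \<sigma>1: "\<sigma> 1 = 1" and \<sigma>_add: "\<And>a b. a \<in> F \<Longrightarrow> b \<in> F \<Longrightarrow> \<sigma> (a + b) = \<sigma> a + \<sigma> b"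
    and \<sigma>_mult: "\<And>a b. a \<in> F \<Longrightarrow> b \<in> F \<Longrightarrow> \<sigma> (a * b) = \<sigma> a * \<sigma> b"
    using \<sigma> by (auto simp: embeddings_def)
  have \<sigma>0: "\<sigma> 0 = 0" using \<sigma>_add[OF subfield_0 subfield_0] by simp
  have \<sigma>_nat: "\<sigma> (of_nat n) = of_nat n" for n
    by (induction n) (use subfield_of_int[of "int _"] in
      \<open>simp_all add: \<sigma>0 \<sigma>1 \<sigma>_add subfield_1\<close>)
  have \<sigma>_int: "\<sigma> (of_int n) = of_int n" for n
  proof (cases "n \<ge> 0")
    case True
    then show ?thesis using \<sigma>_nat[of "nat n"] by simp
  next
    case False
    have "\<sigma> (of_int n + of_int (- n)) = \<sigma> (of_int n) + \<sigma> (of_int (- n))"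
      by (intro \<sigma>_add subfield_of_int)
    moreover have "\<sigma> (of_int (- n)) = of_int (- n)"
      using \<sigma>_nat[of "nat (- n)"] False by simp
    ultimately show ?thesis by (simp add: \<sigma>0)
  qed
  \<comment> \<open>Membership in \<open>F\<close> is carried through the induction because
    \<open>\<sigma>\<close> is known to be additive and multiplicative only on
    \<open>F\<close>.\<close>
  have poly: "poly (map_poly of_int f) a \<in> F \<and>
      \<sigma> (poly (map_poly of_int f) a) = poly (map_poly of_int f) (\<sigma> a)" for f
  proof (induction f)
    case 0
    show ?case by (simp add: subfield_0 \<sigma>0)
  next
    case (pCons c f)
    then show ?case using a(1)
      by (simp add: map_poly_pCons subfield_add subfield_mult subfield_of_int \<sigma>_add \<sigma>_mult \<sigma>_int)
  qed
  from a(2) obtain f where f: "poly (map_poly of_int f) a = 0" "lead_coeff f = 1"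
    by (auto simp: algebraic_int_altdef_ipoly)
  then have "poly (map_poly of_int f) (\<sigma> a) = 0" using poly[of f] \<sigma>0 by metis
  then show ?thesis using f(2) by (auto simp: algebraic_int_altdef_ipoly)
qed

end

section \<open>Sums and products of algebraic integers, by integer matrices\<close>

text \<open>The hypotheses make \<open>z\<close> an eigenvalue of the integer matrix
  \<open>A\<close>, hence a root of its characteristic polynomial, which is monic with integer
  coefficients. An arbitrary finite index set allows pairs as indices.\<close>

lemma algebraic_int_eigenvalue:
  fixes z :: "'a::field_char_0" and A :: "'i \<Rightarrow> 'i \<Rightarrow> int"
  assumes "finite I" "k \<in> I" "v k \<noteq> 0"
    and eig: "\<And>i. i \<in> I \<Longrightarrow> z * v i = (\<Sum>j\<in>I. of_int (A i j) * v j)"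
  shows "algebraic_int z"
proof -
  define n where "n = card I"
  obtain h where h: "bij_betw h {0..<n} I"
    using ex_bij_betw_nat_finite[OF assms(1)] n_def by blast
  define B where "B = mat n n (\<lambda>(i, j). A (h i) (h j))"
  define w where "w = vec n (\<lambda>i. v (h i))"
  have B: "B \<in> carrier_mat n n" by (simp add: B_def)
  have hI: "h i \<in> I" if "i < n" for i using h that by (auto simp: bij_betw_def)
  obtain l where l: "l < n" "h l = k" using h assms(2) by (force simp: bij_betw_def)
  have "w \<noteq> 0\<^sub>v n"
  proof
    assume "w = 0\<^sub>v n"
    then have "w $ l = 0\<^sub>v n $ l" by simp
    then show False using l assms(3) by (simp add: w_def)
  qed
  moreover have "map_mat of_int B *\<^sub>v w = z \<cdot>\<^sub>v w"
  proof (rule eq_vecI)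
    fix i assume "i < dim_vec (z \<cdot>\<^sub>v w)"
    then have i: "i < n" by (simp add: w_def)
    then have "(map_mat of_int B *\<^sub>v w) $ i = (\<Sum>j\<in>{0..<n}. of_int (A (h i) (h j)) * v (h j))"
      by (auto simp: B_def w_def scalar_prod_def intro!: sum.cong)
    also have "\<dots> = (\<Sum>j\<in>I. of_int (A (h i) j) * v j)"
      by (rule sum.reindex_bij_betw[OF h])
    also have "\<dots> = (z \<cdot>\<^sub>v w) $ i" using eig[OF hI[OF i]] i by (simp add: w_def)
    finally show "(map_mat of_int B *\<^sub>v w) $ i = (z \<cdot>\<^sub>v w) $ i" .
  qed (simp add: B_def w_def)
  ultimately have "eigenvalue (map_mat of_int B) z"
    unfolding eigenvalue_def eigenvector_def by (intro exI[of _ w]) (simp add: B_def w_def)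
  then have "poly (char_poly (map_mat of_int B)) z = 0"
    using eigenvalue_root_char_poly[of "map_mat of_int B" n z] B by simp
  then have "poly (map_poly of_int (char_poly B)) z = 0"
    by (simp add: of_int_hom.char_poly_hom[OF B])
  then show ?thesis
    using degree_monic_char_poly[OF B] by (auto simp: algebraic_int_altdef_ipoly)
qed

lemma algebraic_int_companion:
  fixes z :: "'a::field_char_0"
  assumes "algebraic_int z"
  obtains n and A :: "nat \<Rightarrow> nat \<Rightarrow> int"
  where "n > 0" and "\<And>i. i < n \<Longrightarrow> z * z ^ i = (\<Sum>j<n. of_int (A i j) * z ^ j)"
proof -
  obtain f where f: "poly (map_poly of_int f) z = 0" "lead_coeff f = 1"
    using assms by (auto simp: algebraic_int_altdef_ipoly)
  define n where "n = degree f"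
  \<comment> \<open>This is the companion matrix of \<open>f\<close>: each row shifts to the next
    power, and the last one rewrites \<open>z ^ n\<close> by means of \<open>f\<close>.\<close>
  define A where "A i j = (if Suc i < n then of_bool (j = Suc i) else - coeff f j)" for i j
  have sum0: "(\<Sum>j<n. of_int (coeff f j) * z ^ j) + z ^ n = 0"
    using f by (simp add: poly_altdef n_def lessThan_Suc_atMost[symmetric])
  have "n > 0"
  proof (rule ccontr)
    assume "\<not> n > 0"
    then show False using sum0 by simp
  qed
  moreover have "z * z ^ i = (\<Sum>j<n. of_int (A i j) * z ^ j)" if "i < n" for i
  proof (cases "Suc i < n")
    case True
    then have "(\<Sum>j<n. of_int (A i j) * z ^ j) = (\<Sum>j<n. if j = Suc i then z ^ j else 0)"
      by (intro sum.cong) (auto simp: A_def)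
    then show ?thesis using True by simp
  next
    case False
    then have "Suc i = n" using that by simp
    then show ?thesis using False sum0
      by (simp add: A_def sum_negf eq_neg_iff_add_eq_0 add.commute flip: power_Suc)
  qed
  ultimately show thesis by (rule that)
qed

text \<open>On the vector of products \<open>x ^ i * y ^ j\<close>, multiplication by
  \<open>x + y\<close> acts as the integer matrix \<open>A \<otimes> 1 + 1 \<otimes> B\<close>, and
  multiplication by \<open>x * y\<close> as \<open>A \<otimes> B\<close>, where \<open>A\<close> and
  \<open>B\<close> are companion matrices of \<open>x\<close> and \<open>y\<close>. The entry at
  \<open>(0, 0)\<close> is 1, so the vector is nonzero.\<close>

lemma
  fixes x y :: "'a::field_char_0"
  assumes x: "algebraic_int x" and y: "algebraic_int y"
  shows algebraic_int_add: "algebraic_int (x + y)"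
    and algebraic_int_mult: "algebraic_int (x * y)"
proof -
  obtain n A where n: "n > 0" and A: "\<And>i. i < n \<Longrightarrow> x * x ^ i = (\<Sum>k<n. of_int (A i k) * x ^ k)"
    using algebraic_int_companion[OF x] by metis
  obtain m B where m: "m > 0" and B: "\<And>j. j < m \<Longrightarrow> y * y ^ j = (\<Sum>l<m. of_int (B j l) * y ^ l)"
    using algebraic_int_companion[OF y] by metis
  define I where "I = {..<n} \<times> {..<m}"
  define v where "v = (\<lambda>(i, j). x ^ i * y ^ j)"
  have I: "finite I" "(0, 0) \<in> I" and v0: "v (0, 0) \<noteq> 0" using n m by (simp_all add: I_def v_def)
  show "algebraic_int (x + y)"
  proof (rule algebraic_int_eigenvalue[of I "(0, 0)" v, OF I v0])
    fix ij assume "ij \<in> I"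
    then obtain i j where ij: "ij = (i, j)" "i < n" "j < m" by (auto simp: I_def)
    have "(\<Sum>l<m. of_int (if l = j then A i k else 0) * (x ^ k * y ^ l)) = of_int (A i k) * x ^ k * y ^ j"
      for k
    proof -
      have "(\<Sum>l<m. of_int (if l = j then A i k else 0) * (x ^ k * y ^ l)) =
          (\<Sum>l<m. if l = j then of_int (A i k) * x ^ k * y ^ l else 0)"
        by (intro sum.cong) auto
      then show ?thesis using ij by simp
    qed
    then have 1: "(\<Sum>k<n. \<Sum>l<m. of_int (if l = j then A i k else 0) * (x ^ k * y ^ l)) = (x * x ^ i) * y ^ j"
      by (simp add: A[OF ij(2)] sum_distrib_right)
    have "(\<Sum>l<m. of_int (if k = i then B j l else 0) * (x ^ k * y ^ l)) =
        (if k = i then x ^ k * (y * y ^ j) else 0)" for k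
      by (simp add: B[OF ij(3)] sum_distrib_left mult_ac)
    then have 2: "(\<Sum>k<n. \<Sum>l<m. of_int (if k = i then B j l else 0) * (x ^ k * y ^ l)) = x ^ i * (y * y ^ j)"
      using ij by simp
    have "(x + y) * v ij = (x * x ^ i) * y ^ j + x ^ i * (y * y ^ j)"
      by (simp add: ij v_def algebra_simps)
    also have "\<dots> = (\<Sum>k<n. \<Sum>l<m.
        of_int ((if l = j then A i k else 0) + (if k = i then B j l else 0)) * (x ^ k * y ^ l))"
      unfolding 1[symmetric] 2[symmetric] by (simp only: of_int_add distrib_right sum.distrib)
    also have "\<dots> = (\<Sum>kl\<in>I. of_int ((\<lambda>(i, j) (k, l).
        (if l = j then A i k else 0) + (if k = i then B j l else 0)) ij kl) * v kl)"
      unfolding I_def v_def ij sum.cartesian_product prod.case by (auto intro!: sum.cong)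
    finally show "(x + y) * v ij = \<dots>" .
  qed
  show "algebraic_int (x * y)"
  proof (rule algebraic_int_eigenvalue[of I "(0, 0)" v, OF I v0])
    fix ij assume "ij \<in> I"
    then obtain i j where ij: "ij = (i, j)" "i < n" "j < m" by (auto simp: I_def)
    have "(x * y) * v ij = (x * x ^ i) * (y * y ^ j)" by (simp add: ij v_def)
    also have "\<dots> = (\<Sum>k<n. \<Sum>l<m. of_int (A i k * B j l) * (x ^ k * y ^ l))"
      unfolding A[OF ij(2)] B[OF ij(3)] by (simp add: sum_product mult_ac)
    also have "\<dots> = (\<Sum>kl\<in>I. of_int ((\<lambda>(i, j) (k, l). A i k * B j l) ij kl) * v kl)"
      unfolding I_def v_def ij sum.cartesian_product prod.case by (auto intro!: sum.cong)
    finally show "(x * y) * v ij = \<dots>" .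
  qed
qed

section \<open>Adjoining square roots to the rationals\<close>

text \<open>A subfield containing \<open>S\<close> and \<open>s\<close> contains the hull
  \<open>F\<close> and so every \<open>a + b * s\<close>; these already form a field. Two
  applications describe the biquadratic field as a tower.\<close>

lemma rat_adjoin_insert:
  assumes "is_subfield F" "F = rat_adjoin S" "s * s \<in> F"
  shows "rat_adjoin (insert s S) = quadratic_extension F s"
  unfolding rat_adjoin_def
proof (rule hull_unique)
  have "S \<subseteq> F" using assms(2) by (simp add: rat_adjoin_def hull_subset)
  then show "insert s S \<subseteq> quadratic_extension F s"
    using quadratic_extension_base[OF assms(1)] quadratic_extension_generator[OF assms(1)] by auto
  show "is_subfield (quadratic_extension F s)"
    by (rule is_subfield_quadratic_extension[OF assms(1,3)])
  fix L assume L: "insert s S \<subseteq> L" "is_subfield L"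
  then have "F \<subseteq> L" using assms(2) by (simp add: rat_adjoin_def hull_minimal)
  then show "quadratic_extension F s \<subseteq> L"
    using L by (auto simp: quadratic_extension_def intro!: subfield_add subfield_mult)
qed

lemma is_subfield_Rats: "is_subfield \<rat>"
  by (simp add: is_subfield_def)

lemma rat_adjoin_empty: "rat_adjoin {} = \<rat>"
  unfolding rat_adjoin_def
  by (rule hull_unique) (auto simp: is_subfield_Rats subfield_of_rat elim!: Rats_cases)

text \<open>The elements 1 and \<open>s\<close> span. Degree 4 thereby rules out a collapse of
  either step of the tower.\<close>

lemma degree_over_rat_quadratic_extension_Rats:
  "degree_over_rat (quadratic_extension \<rat> s) \<le> 2"
proof -
  have "quadratic_extension \<rat> s \<subseteq> rat_vs.span {1, s}"
  proof
    fix v assume "v \<in> quadratic_extension \<rat> s"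
    then obtain a b where v: "v = of_rat a * 1 + of_rat b * s"
      by (auto simp: quadratic_extension_def Rats_def)
    show "v \<in> rat_vs.span {1, s}"
      unfolding v by (intro rat_vs.span_add rat_vs.span_scale rat_vs.span_base) auto
  qed
  then have "rat_vs.dim (quadratic_extension \<rat> s) \<le> card {1, s}"
    by (rule rat_vs.dim_le_card) simp
  also have "\<dots> \<le> 2" by (simp add: card_insert_if)
  finally show ?thesis by (simp add: degree_over_rat_def)
qed

section \<open>Squarefree integers and the size estimate\<close>

text \<open>With \<open>c = u / v\<close> in lowest terms, \<open>v\<^sup>2\<close> divides
  \<open>m * u\<^sup>2\<close> and is coprime to \<open>u\<^sup>2\<close>, so it divides the
  squarefree \<open>m\<close>.\<close>

lemma rat_square_times_squarefree_Ints:
  fixes m :: int and c :: rat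
  assumes "squarefree m" "of_int m * c\<^sup>2 \<in> \<int>"
  shows "c \<in> \<int>"
proof (cases c)
  case (Fract u v)
  from assms(2) obtain k where k: "of_int m * c\<^sup>2 = of_int k" by (elim Ints_cases)
  have c: "c = of_int u / of_int v" and v: "v > 0"
    using Fract by (simp_all add: Fract_of_int_quotient)
  have "(of_int (m * u\<^sup>2) :: rat) = of_int (k * v\<^sup>2)"
    using k v unfolding c by (simp add: field_simps)
  then have "m * u\<^sup>2 = k * v\<^sup>2" by (simp only: of_int_eq_iff)
  then have "v\<^sup>2 dvd m * u\<^sup>2" by simp
  moreover have "coprime (v\<^sup>2) (u\<^sup>2)" using Fract by (simp add: coprime_commute)
  ultimately have "v\<^sup>2 dvd m" by (simp add: coprime_dvd_mult_left_iff)
  then have "v = 1" using assms(1) Fract by (auto simp: squarefree_def)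
  then show ?thesis using c by simp
qed

text \<open>The square of \<open>4 * c * s\<close> is rational and an algebraic integer, hence an
  integer; so \<open>4 * c\<close> is a nonzero integer and \<open>m\<close> is at most that square,
  which is below \<open>(2 * x)\<^sup>2\<close>. It serves for both irrational coefficients, with
  \<open>m\<close> equal to \<open>q\<close> or to \<open>r\<close>.\<close>

lemma squarefree_less_16_square:
  fixes m :: int and c x :: rat and s :: real
  assumes "m > 0" "squarefree m" "c \<noteq> 0" and s: "s * s = of_int m"
    and int: "algebraic_int (4 * (of_rat c * s))" and less: "2 * \<bar>of_rat c * s\<bar> < of_rat x"
  shows "of_int m < 16 * x\<^sup>2"
proof -
  have sq: "(4 * (of_rat c * s))\<^sup>2 = of_rat (of_int m * (4 * c)\<^sup>2)"
    by (simp add: power_mult_distrib s[symmetric] of_rat_mult of_rat_power power2_eq_square)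
  have "algebraic_int ((4 * (of_rat c * s))\<^sup>2)"
    unfolding power2_eq_square by (rule algebraic_int_mult[OF int int])
  then have "(4 * (of_rat c * s))\<^sup>2 \<in> \<int>"
    unfolding sq by (intro rational_algebraic_int_is_int) simp_all
  then obtain k where "(of_rat (of_int m * (4 * c)\<^sup>2) :: real) = of_int k"
    unfolding sq by (elim Ints_cases)
  then have "(of_rat (of_int m * (4 * c)\<^sup>2) :: real) = of_rat (of_int k)" by simp
  then have "of_int m * (4 * c)\<^sup>2 = of_int k" by (simp only: of_rat_eq_iff)
  then have "4 * c \<in> \<int>" using rat_square_times_squarefree_Ints[OF assms(2)] by simp
  then have "1 \<le> \<bar>4 * c\<bar>" using assms(3) by (intro Ints_nonzero_abs_ge1) simp_all
  then have "1 \<le> (4 * c)\<^sup>2" using power_mono[of 1 "\<bar>4 * c\<bar>" 2] by simp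
  then have "of_int m * 1 \<le> of_int m * (4 * c)\<^sup>2"
    using assms(1) by (intro mult_left_mono) simp_all
  moreover have "of_rat (of_int m * (4 * c)\<^sup>2) < (of_rat (4 * x\<^sup>2) :: real)"
  proof -
    have "(4 * (of_rat c * s))\<^sup>2 = (2 * (2 * \<bar>of_rat c * s\<bar>))\<^sup>2"
      by (simp add: power_mult_distrib)
    also have "\<dots> < (2 * of_rat x)\<^sup>2"
      using less by (intro power_strict_mono) simp_all
    finally show ?thesis unfolding sq by (simp add: of_rat_mult of_rat_power power_mult_distrib)
  qed
  then have "of_int m * (4 * c)\<^sup>2 < 4 * x\<^sup>2" by (simp only: of_rat_less)
  \<comment> \<open>The estimate has reached \<open>m < 4 * x\<^sup>2\<close>; here it is relaxed to
    the stated constant.\<close>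
  moreover have "4 * x\<^sup>2 \<le> 16 * x\<^sup>2" by simp
  ultimately show ?thesis by linarith
qed

section \<open>Conjugates of a decomposition in the biquadratic field\<close>

theorem theorem3p5:
  fixes p q :: int and x y r :: rat and K :: "real set" and \<alpha> \<alpha>' :: real
  assumes "p > 1" and "squarefree p"
    and "indecomposable (rat_adjoin {sqrt (of_int p)}) (of_rat x + of_rat y * sqrt (of_int p))"
    and "q > 0" and "squarefree q"
    and "K = rat_adjoin {sqrt (of_int p), sqrt (of_int q)}"
    and "degree_over_rat K = 4"
    and "r = of_int (p * q) / of_int ((gcd p q)\<^sup>2)"
    and "\<alpha> \<in> totally_positive_integers K" and "\<alpha>' \<in> totally_positive_integers K"
    and "of_rat x + of_rat y * sqrt (of_int p) = \<alpha> + \<alpha>'"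
  shows "min (of_int q) r < 16 * x\<^sup>2"
proof -
  define P Q where "P = sqrt (of_int p)" and "Q = sqrt (of_int q)"
  have PP: "P * P = of_int p" and QQ: "Q * Q = of_int q" using assms(1,4) by (simp_all add: P_def Q_def)
  define F where "F = quadratic_extension \<rat> P"
  have P_eq: "rat_adjoin {P} = F"
    unfolding F_def by (rule rat_adjoin_insert[OF is_subfield_Rats rat_adjoin_empty[symmetric]]) (simp add: PP)
  have F: "is_subfield F"
    unfolding F_def by (rule is_subfield_quadratic_extension[OF is_subfield_Rats]) (simp add: PP)
  have QF: "Q * Q \<in> F" using QQ subfield_of_int[OF F] by simp
  have K: "K = quadratic_extension F Q"
    using rat_adjoin_insert[OF F P_eq[symmetric] QF] assms(6) by (simp add: P_def Q_def insert_commute)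
  have P_irrat: "P \<notin> \<rat>"
  proof
    assume "P \<in> \<rat>"
    then have "K = quadratic_extension \<rat> Q"
      by (simp add: K F_def quadratic_extension_eq_base[OF is_subfield_Rats])
    then show False using degree_over_rat_quadratic_extension_Rats[of Q] assms(7) by simp
  qed
  have Q_notin: "Q \<notin> F"
  proof
    assume "Q \<in> F"
    then have "K = quadratic_extension \<rat> P"
      by (simp add: K F_def[symmetric] quadratic_extension_eq_base[OF F])
    then show False using degree_over_rat_quadratic_extension_Rats[of P] assms(7) by simp
  qed
  have subK: "is_subfield K" unfolding K by (rule is_subfield_quadratic_extension[OF F QF])

  have mem: "of_rat a + of_rat b * P \<in> F" for a b
    unfolding F_def quadratic_extension_def using Rats_of_rat by blast

  \<comment> \<open>For each choice of signs \<open>e\<close>, \<open>f\<close>, the inclusion of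
    the rationals is extended first by \<open>P \<mapsto> e * P\<close> and then by
    \<open>Q \<mapsto> f * Q\<close>.\<close>
  have conjugate: "\<exists>\<sigma>\<in>embeddings K. \<forall>a b c d. \<sigma> (of_rat a + of_rat b * P + (of_rat c + of_rat d * P) * Q) =
      complex_of_real (of_rat a + of_rat b * (e * P) + (of_rat c + of_rat d * (e * P)) * (f * Q))"
    if ef: "e\<^sup>2 = 1" "f\<^sup>2 = 1" for e f
  proof -
    have square: "complex_of_real (u * s) * complex_of_real (u * s) = complex_of_real (s * s)"
      if "u\<^sup>2 = 1" for u s
      using that by (simp add: power2_eq_square flip: of_real_mult)
    have emb: "complex_of_real \<in> embeddings \<rat>" by (simp add: embeddings_def)
    have PQ: "P * P \<in> \<rat>" by (simp add: PP)
    obtain \<tau> where \<tau>: "\<tau> \<in> embeddings F"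
      "\<And>a b. a \<in> \<rat> \<Longrightarrow> b \<in> \<rat> \<Longrightarrow> \<tau> (a + b * P) = complex_of_real a + complex_of_real b * complex_of_real (e * P)"
      using extend_embedding[OF is_subfield_Rats P_irrat PQ emb square[OF ef(1)], folded F_def] by blast
    have "\<tau> (Q * Q) = complex_of_real (Q * Q)" using \<tau>(2)[of "of_int q" 0] by (simp add: QQ)
    then have \<tau>_QQ: "complex_of_real (f * Q) * complex_of_real (f * Q) = \<tau> (Q * Q)"
      by (simp only: square[OF ef(2)])
    obtain \<sigma> where \<sigma>: "\<sigma> \<in> embeddings K"
      "\<And>a b. a \<in> F \<Longrightarrow> b \<in> F \<Longrightarrow> \<sigma> (a + b * Q) = \<tau> a + \<tau> b * complex_of_real (f * Q)"
      using extend_embedding[OF F Q_notin QF \<tau>(1) \<tau>_QQ, folded K] by blast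
    show ?thesis
    proof (intro bexI[of _ \<sigma>] allI)
      fix a b c d
      show "\<sigma> (of_rat a + of_rat b * P + (of_rat c + of_rat d * P) * Q) =
        complex_of_real (of_rat a + of_rat b * (e * P) + (of_rat c + of_rat d * (e * P)) * (f * Q))"
        unfolding \<sigma>(2)[OF mem mem] \<tau>(2)[OF Rats_of_rat Rats_of_rat] by simp
    qed (fact \<sigma>(1))
  qed

  have \<alpha>: "\<alpha> \<in> K" "algebraic_int \<alpha>" and \<alpha>': "\<alpha>' \<in> K"
    using assms(9,10) by (auto simp: totally_positive_integers_def ring_of_integers_def)
  then obtain a b c d where \<alpha>_eq: "\<alpha> = of_rat a + of_rat b * P + (of_rat c + of_rat d * P) * Q"
    unfolding K quadratic_extension_def F_def by (auto simp: Rats_def)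
  have \<alpha>'_eq: "\<alpha>' = of_rat (x - a) + of_rat (y - b) * P + (of_rat (- c) + of_rat (- d) * P) * Q"
    using assms(11) \<alpha>_eq by (simp add: P_def[symmetric] of_rat_diff of_rat_minus algebra_simps)

  \<comment> \<open>\<open>\<phi> e f\<close> and \<open>\<phi>' e f\<close> are the conjugates of
    \<open>\<alpha>\<close> and \<open>\<alpha>'\<close>, kept as real numbers so that they can be
    compared.\<close>
  define \<phi> where "\<phi> e f = of_rat a + of_rat b * (e * P) + (of_rat c + of_rat d * (e * P)) * (f * Q)"
    for e f :: real
  define \<phi>' where "\<phi>' e f = of_rat (x - a) + of_rat (y - b) * (e * P) +
    (of_rat (- c) + of_rat (- d) * (e * P)) * (f * Q)" for e f :: real
  have \<phi>: "\<phi> e f > 0 \<and> \<phi>' e f > 0 \<and> algebraic_int (\<phi> e f)"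
    if ef: "e\<^sup>2 = 1" "f\<^sup>2 = 1" for e f
  proof -
    obtain \<sigma> where \<sigma>: "\<sigma> \<in> embeddings K" "\<sigma> \<alpha> = complex_of_real (\<phi> e f)" "\<sigma> \<alpha>' = complex_of_real (\<phi>' e f)"
      using conjugate[OF ef] unfolding \<alpha>_eq \<alpha>'_eq \<phi>_def \<phi>'_def by blast
    have "Re (\<sigma> \<alpha>) > 0" "Re (\<sigma> \<alpha>') > 0"
      using assms(9,10) \<sigma>(1) by (auto simp: totally_positive_integers_def)
    then show ?thesis
      using algebraic_int_embedding[OF subK \<sigma>(1) \<alpha>]
      by (simp only: \<sigma> Re_complex_of_real algebraic_int_of_real_iff)
  qed
  have pos: "\<phi> 1 1 > 0" "\<phi> 1 (-1) > 0" "\<phi> (-1) 1 > 0" "\<phi> (-1) (-1) > 0"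
    "\<phi>' 1 1 > 0" "\<phi>' 1 (-1) > 0" "\<phi>' (-1) 1 > 0" "\<phi>' (-1) (-1) > 0"
    by (simp_all add: \<phi>)
  have int: "algebraic_int (\<phi> 1 1)" "algebraic_int (\<phi> 1 (-1))"
    "algebraic_int (\<phi> (-1) 1)" "algebraic_int (\<phi> (-1) (-1))"
    by (simp_all add: \<phi>)
  \<comment> \<open>Adding the conjugates with equal \<open>f\<close> cancels \<open>b\<close> and
    \<open>d\<close>.\<close>
  have c_less: "2 * \<bar>of_rat c * Q\<bar> < of_rat x"
    using pos by (simp add: \<phi>_def \<phi>'_def of_rat_diff of_rat_minus algebra_simps abs_less_iff)
  \<comment> \<open>Here the conjugates with equal product \<open>e * f\<close> are added, which
    cancels \<open>b\<close> and \<open>c\<close>.\<close>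
  have d_less: "2 * \<bar>of_rat d * (P * Q)\<bar> < of_rat x"
    using pos by (simp add: \<phi>_def \<phi>'_def of_rat_diff of_rat_minus algebra_simps abs_less_iff)
  \<comment> \<open>Weighting the conjugates by the sign \<open>f\<close> isolates the coefficient
    of \<open>Q\<close>; weighting by \<open>e * f\<close> below isolates that of
    \<open>P * Q\<close>.\<close>
  have "algebraic_int (\<phi> 1 1 + \<phi> (-1) 1 + - (\<phi> 1 (-1) + \<phi> (-1) (-1)))"
    using int by (intro algebraic_int_add algebraic_int_minus)
  then have c_int: "algebraic_int (4 * (of_rat c * Q))" by (simp add: \<phi>_def algebra_simps)
  have "algebraic_int (\<phi> 1 1 + \<phi> (-1) (-1) + - (\<phi> 1 (-1) + \<phi> (-1) 1))"
    using int by (intro algebraic_int_add algebraic_int_minus)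
  then have d_int: "algebraic_int (4 * (of_rat d * (P * Q)))" by (simp add: \<phi>_def algebra_simps)

  consider "c \<noteq> 0" | "d \<noteq> 0" | "c = 0" "d = 0" by blast
  then show ?thesis
  proof cases
    case 1
    then have "of_int q < 16 * x\<^sup>2"
      using squarefree_less_16_square[OF assms(4,5) _ QQ c_int c_less] by blast
    then show ?thesis by simp
  next
    case 2
    define g where "g = gcd p q"
    \<comment> \<open>\<open>m\<close> is the integer \<open>r\<close>, and \<open>P * Q / g\<close>
      is a square root of it. The coefficient \<open>d\<close> of \<open>P * Q\<close> accordingly
      becomes \<open>d * g\<close>.\<close>
    define m where "m = (p div g) * (q div g)"
    have g: "g > 0" "g dvd p" "g dvd q" using assms(1) by (simp_all add: g_def)
    have pq: "p * q = m * g\<^sup>2" using g by (auto simp: m_def power2_eq_square elim!: dvdE)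
    then have r: "r = of_int m" using g(1) by (simp add: assms(8) g_def[symmetric])
    have "(P * Q) * (P * Q) = of_int (p * q)" using PP QQ by (simp add: mult_ac)
    then have PQm: "(P * Q / of_int g) * (P * Q / of_int g) = of_int m"
      using g(1) by (simp add: pq power2_eq_square)
    have "m > 0" using assms(1,4) g by (simp add: m_def pos_imp_zdiv_pos_iff zdvd_imp_le)
    \<comment> \<open>The factors are coprime after division by the gcd, and each divides a
      squarefree number.\<close>
    moreover have "squarefree m"
      unfolding m_def
    proof (rule squarefree_mult_coprime)
      show "coprime (p div g) (q div g)" using assms(1) by (simp add: g_def div_gcd_coprime)
      have "p div g dvd p" "q div g dvd q"
        using g by (metis dvd_div_mult_self dvd_triv_left)+
      then show "squarefree (p div g)" "squarefree (q div g)"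
        using assms(2,5) by (auto intro: squarefree_mono)
    qed
    moreover have "of_rat (d * of_int g) * (P * Q / of_int g) = of_rat d * (P * Q)"
      using g(1) by (simp add: of_rat_mult)
    ultimately have "of_int m < 16 * x\<^sup>2"
      using squarefree_less_16_square[of m "d * of_int g" "P * Q / of_int g" x] PQm d_int d_less 2 g(1)
      by simp
    then show ?thesis using r by simp
  next
    \<comment> \<open>Both summands lie in \<open>F\<close> and are totally positive there, against
      indecomposability.\<close>
    case 3
    have "\<alpha> \<in> F" "\<alpha>' \<in> F"
      using mem unfolding \<alpha>_eq \<alpha>'_eq 3 by simp_all
    then have "\<alpha> \<in> totally_positive_integers F" "\<alpha>' \<in> totally_positive_integers F"
      using totally_positive_integers_base[OF F Q_notin QF] assms(9,10) unfolding K by blast+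
    then show ?thesis
      using assms(3,11) unfolding indecomposable_def P_def[symmetric] P_eq by blast
  qed
qed

end
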